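(* Let $\Phi$ be an Orlicz function, let $w=(w_m)_{m\in\mathbb{Z}}$ be a sequence of weights with $w_m>0$ for every $m\in\mathbb{Z}$, and let $k\in\mathbb{R}$. Then $$\operatorname{span}\,\mathsf{c}_{k,\Phi,w}=l_{k,\Phi,w},$$ and $l_{k,\Phi,w}$ is a complex Banach space with respect to the norm $\|\cdot\|_{k,\Phi,w}$.
   Context: An Orlicz function is a continuous, non-decreasing, convex function $\Phi:[0,+\infty)\to[0,+\infty)$ with $\Phi(0)=0$, $\Phi(t)>0$ for every $t>0$ and $\lim_{t\to+\infty}\Phi(t)=+\infty$. Given such $\Phi$, positive weights $w=(w_m)_{m\in\mathbb{Z}}$ and $k\in\mathbb{R}$, the class $\mathsf{c}_{k,\Phi,w}$ is the set of all complex sequences $\mathsf{p}=(p_m)_{m\in\mathbb{Z}}$ satisfying $$\sum_{m\in\mathbb{Z}}w_m(1+\Phi(|m|))^k\,\Phi(|p_m|)<+\infty.$$ For a complex sequence $\mathsf{p}=(p_m)_{m\in\mathbb{Z}}$ put $$\|\mathsf{p}\|_{k,\Phi,w}:=\inf\Big\{\rho>0:\ \sum_{m\in\mathbb{Z}}w_m(1+\Phi(|m|))^k\,\Phi\Big(\frac{|p_m|}{\rho}\Big)\le 1\Big\}$$ (with $\inf\emptyset=+\infty$), and let $l_{k,\Phi,w}$ be the set of all complex sequences $\mathsf{p}$ with $\|\mathsf{p}\|_{k,\Phi,w}<+\infty$, with the usual componentwise algebraic operations. $\operatorname{span}$ denotes the complex linear span in the space of all complex sequences indexed by $\mathbb{Z}$.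 *)

theory Defs
  imports "HOL-Analysis.Analysis" "HOL-Library.Function_Algebras"
begin

definition cseq_scale :: "complex \<Rightarrow> (int \<Rightarrow> complex) \<Rightarrow> (int \<Rightarrow> complex)" where
  "cseq_scale c p = (\<lambda>m. c * p m)"

text \<open>Sums, differences and zero of sequences are the componentwise ones of
  \<^theory>\<open>HOL-Library.Function_Algebras\<close>.\<close>

global_interpretation cseq: vector_space cseq_scale
  by unfold_locales (auto simp: cseq_scale_def fun_eq_iff algebra_simps)

definition orlicz_function :: "(real \<Rightarrow> real) \<Rightarrow> bool" where
  "orlicz_function \<Phi> \<longleftrightarrow>
     \<Phi> \<in> {0..} \<rightarrow> {0..} \<and>
     continuous_on {0..} \<Phi> \<and>
     mono_on {0..} \<Phi> \<and>
     convex_on {0..} \<Phi> \<and>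
     \<Phi> 0 = 0 \<and>
     (\<forall>t>0. \<Phi> t > 0) \<and>
     filterlim \<Phi> at_top at_top"

text \<open>The modular takes the sequence of moduli as its argument \<open>a\<close>; its terms are
  nonnegative, so \<^const>\<open>ennreal\<close> truncates nothing and the sum always exists in
  \<^typ>\<open>ennreal\<close>.\<close>

definition orlicz_modular ::
    "real \<Rightarrow> (real \<Rightarrow> real) \<Rightarrow> (int \<Rightarrow> real) \<Rightarrow> (int \<Rightarrow> real) \<Rightarrow> ennreal" where
  "orlicz_modular k \<Phi> w a =
     (\<Sum>\<^sub>\<infinity>m\<in>UNIV. ennreal (w m * (1 + \<Phi> \<bar>real_of_int m\<bar>) powr k * \<Phi> (a m)))"

definition orlicz_class ::
    "real \<Rightarrow> (real \<Rightarrow> real) \<Rightarrow> (int \<Rightarrow> real) \<Rightarrow> (int \<Rightarrow> complex) set" where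
  "orlicz_class k \<Phi> w = {p. orlicz_modular k \<Phi> w (\<lambda>m. cmod (p m)) < \<infinity>}"

text \<open>In \<^typ>\<open>ennreal\<close> the infimum of the empty set is \<open>\<infinity>\<close>.\<close>

definition luxemburg_norm ::
    "real \<Rightarrow> (real \<Rightarrow> real) \<Rightarrow> (int \<Rightarrow> real) \<Rightarrow> (int \<Rightarrow> complex) \<Rightarrow> ennreal" where
  "luxemburg_norm k \<Phi> w p =
     Inf {ennreal \<rho> | \<rho>. \<rho> > 0 \<and> orlicz_modular k \<Phi> w (\<lambda>m. cmod (p m) / \<rho>) \<le> 1}"

definition orlicz_space ::
    "real \<Rightarrow> (real \<Rightarrow> real) \<Rightarrow> (int \<Rightarrow> real) \<Rightarrow> (int \<Rightarrow> complex) set" where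
  "orlicz_space k \<Phi> w = {p. luxemburg_norm k \<Phi> w p < \<infinity>}"

definition complex_normed_space_on ::
    "(int \<Rightarrow> complex) set \<Rightarrow> ((int \<Rightarrow> complex) \<Rightarrow> real) \<Rightarrow> bool" where
  "complex_normed_space_on V N \<longleftrightarrow>
     cseq.subspace V \<and>
     (\<forall>p\<in>V. N p \<ge> 0) \<and>
     (\<forall>p\<in>V. N p = 0 \<longleftrightarrow> p = 0) \<and>
     (\<forall>c. \<forall>p\<in>V. N (cseq_scale c p) = cmod c * N p) \<and>
     (\<forall>p\<in>V. \<forall>q\<in>V. N (p + q) \<le> N p + N q)"

definition complex_banach_space_on ::
    "(int \<Rightarrow> complex) set \<Rightarrow> ((int \<Rightarrow> complex) \<Rightarrow> real) \<Rightarrow> bool" where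
  "complex_banach_space_on V N \<longleftrightarrow>
     complex_normed_space_on V N \<and> Metric_space.mcomplete V (\<lambda>p q. N (p - q))"

end

(* Bounding the modular of p / \<rho> by 1 only involves finite sums of nonnegative reals, so
   convexity of \<Phi> passes to it and makes the norm the gauge of a convex balanced set. Every
   coordinate is controlled by the norm because \<Phi> is unbounded; hence a Cauchy sequence
   converges coordinatewise, and by continuity of \<Phi> each finite-sum bound survives in the
   limit, which gives completeness. *)
theory Submission
  imports Defs
begin

locale weighted_orlicz =
  fixes \<Phi> :: "real \<Rightarrow> real" and w :: "int \<Rightarrow> real" and k :: real
  assumes orlicz: "orlicz_function \<Phi>"
    and w_pos: "\<And>m. w m > 0"
begin

section \<open>Finite-sum form of the modular\<close>

definition weight :: "int \<Rightarrow> real" where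
  "weight m = w m * (1 + \<Phi> \<bar>real_of_int m\<bar>) powr k"

definition modular_le :: "real \<Rightarrow> (int \<Rightarrow> real) \<Rightarrow> bool" where
  "modular_le C a \<longleftrightarrow> (\<forall>F. finite F \<longrightarrow> (\<Sum>m\<in>F. weight m * \<Phi> (a m)) \<le> C)"

text \<open>The scales competing in the infimum that defines the Luxemburg norm. Norm properties are
  first proved for single scales and then passed to the infimum.\<close>

definition unit_scale :: "(int \<Rightarrow> complex) \<Rightarrow> real \<Rightarrow> bool" where
  "unit_scale p \<rho> \<longleftrightarrow> \<rho> > 0 \<and> modular_le 1 (\<lambda>m. cmod (p m) / \<rho>)"

abbreviation L :: "(int \<Rightarrow> complex) set" where
  "L \<equiv> orlicz_space k \<Phi> w"

abbreviation N :: "(int \<Rightarrow> complex) \<Rightarrow> real" where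
  "N p \<equiv> enn2real (luxemburg_norm k \<Phi> w p)"

lemma \<Phi>_nonneg: "t \<ge> 0 \<Longrightarrow> \<Phi> t \<ge> 0"
  and \<Phi>_0: "\<Phi> 0 = 0"
  and \<Phi>_mono: "0 \<le> s \<Longrightarrow> s \<le> t \<Longrightarrow> \<Phi> s \<le> \<Phi> t"
  and \<Phi>_convex: "convex_on {0..} \<Phi>"
  and \<Phi>_cont: "continuous_on {0..} \<Phi>"
  and \<Phi>_at_top: "filterlim \<Phi> at_top at_top"
  using orlicz unfolding orlicz_function_def by (auto simp: Pi_def mono_on_def)

lemma weight_pos: "weight m > 0"
proof -
  have "1 + \<Phi> \<bar>real_of_int m\<bar> > 0"
    using \<Phi>_nonneg[of "\<bar>real_of_int m\<bar>"] by simp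
  then show ?thesis using w_pos[of m] by (simp add: weight_def)
qed

text \<open>A sum of nonnegative terms is the supremum of its finite partial sums, so a bound on it
  is a bound on each of them. With \<open>C\<close> nonnegative, \<open>ennreal C\<close> does not
  truncate.\<close>

lemma orlicz_modular_le_iff:
  assumes "C \<ge> 0" "\<And>m. a m \<ge> 0"
  shows "orlicz_modular k \<Phi> w a \<le> ennreal C \<longleftrightarrow> modular_le C a"
proof -
  have nn: "weight m * \<Phi> (a m) \<ge> 0" for m
    using weight_pos[of m] \<Phi>_nonneg[OF assms(2)[of m]] by simp
  have sum_le: "(\<Sum>m\<in>F. ennreal (weight m * \<Phi> (a m))) \<le> ennreal C \<longleftrightarrow>
      (\<Sum>m\<in>F. weight m * \<Phi> (a m)) \<le> C" for F
    using assms(1) nn by (simp add: sum_ennreal ennreal_le_iff)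
  have "orlicz_modular k \<Phi> w a = (SUP F\<in>{F. finite F}. \<Sum>m\<in>F. ennreal (weight m * \<Phi> (a m)))"
    unfolding orlicz_modular_def weight_def[symmetric]
    by (subst nonneg_infsum_complete) auto
  then show ?thesis
    by (simp add: SUP_le_iff modular_le_def sum_le)
qed

section \<open>Monotonicity, convexity and closedness of modular bounds\<close>

lemma modular_le_mono:
  assumes "modular_le C b" "\<And>m. 0 \<le> a m" "\<And>m. a m \<le> b m"
  shows "modular_le C a"
  unfolding modular_le_def
proof (intro allI impI)
  fix F :: "int set" assume "finite F"
  have "(\<Sum>m\<in>F. weight m * \<Phi> (a m)) \<le> (\<Sum>m\<in>F. weight m * \<Phi> (b m))"
    using assms(2,3) \<Phi>_mono weight_pos by (intro sum_mono mult_left_mono) (auto intro: less_imp_le)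
  also have "\<dots> \<le> C" using assms(1) \<open>finite F\<close> by (simp add: modular_le_def)
  finally show "(\<Sum>m\<in>F. weight m * \<Phi> (a m)) \<le> C" .
qed

lemma modular_le_convex:
  assumes "modular_le C a" "modular_le D b" "\<And>m. 0 \<le> a m" "\<And>m. 0 \<le> b m"
    and "0 \<le> s" "0 \<le> t" "s + t = 1"
  shows "modular_le (s * C + t * D) (\<lambda>m. s * a m + t * b m)"
  unfolding modular_le_def
proof (intro allI impI)
  fix F :: "int set" assume "finite F"
  have "\<Phi> (s * a m + t * b m) \<le> s * \<Phi> (a m) + t * \<Phi> (b m)" for m
    using \<Phi>_convex assms(3-7) by (auto simp: convex_on_def)
  then have "(\<Sum>m\<in>F. weight m * \<Phi> (s * a m + t * b m))
      \<le> (\<Sum>m\<in>F. weight m * (s * \<Phi> (a m) + t * \<Phi> (b m)))"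
    using weight_pos by (intro sum_mono mult_left_mono) (auto intro: less_imp_le)
  also have "\<dots> = s * (\<Sum>m\<in>F. weight m * \<Phi> (a m)) + t * (\<Sum>m\<in>F. weight m * \<Phi> (b m))"
    by (simp add: sum_distrib_left sum.distrib[symmetric] algebra_simps)
  also have "\<dots> \<le> s * C + t * D"
    using assms \<open>finite F\<close> by (intro add_mono mult_left_mono) (auto simp: modular_le_def)
  finally show "(\<Sum>m\<in>F. weight m * \<Phi> (s * a m + t * b m)) \<le> s * C + t * D" .
qed

text \<open>A Fatou-type property: only finitely many terms occur at a time, so continuity of
  \<open>\<Phi>\<close> suffices and no limit is exchanged with an infinite sum.\<close>

lemma modular_le_LIMSEQ:
  assumes "\<And>m. (\<lambda>j. a j m) \<longlonglongrightarrow> b m" "\<And>j m. 0 \<le> a j m"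
    and "eventually (\<lambda>j. modular_le C (a j)) sequentially"
  shows "modular_le C b"
  unfolding modular_le_def
proof (intro allI impI)
  fix F :: "int set" assume "finite F"
  \<comment> \<open>Continuity of \<open>\<Phi>\<close> is available on \<open>{0..}\<close> only,
    so the limit must lie there.\<close>
  have nn: "0 \<le> b m" for m
    using assms(2) by (intro LIMSEQ_le_const[OF assms(1)]) auto
  have "(\<lambda>j. \<Phi> (a j m)) \<longlonglongrightarrow> \<Phi> (b m)" for m
    using assms(2) nn by (intro continuous_on_tendsto_compose[OF \<Phi>_cont assms(1)]) auto
  then have "(\<lambda>j. \<Sum>m\<in>F. weight m * \<Phi> (a j m)) \<longlonglongrightarrow> (\<Sum>m\<in>F. weight m * \<Phi> (b m))"
    by (intro tendsto_intros)
  moreover have "eventually (\<lambda>j. (\<Sum>m\<in>F. weight m * \<Phi> (a j m)) \<le> C) sequentially"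
    using assms(3) by eventually_elim (simp add: modular_le_def \<open>finite F\<close>)
  ultimately show "(\<Sum>m\<in>F. weight m * \<Phi> (b m)) \<le> C"
    by (intro tendsto_upperbound) auto
qed

section \<open>Operations on admissible scales\<close>

lemma unit_scale_mono: "unit_scale p \<rho> \<Longrightarrow> \<rho> \<le> \<sigma> \<Longrightarrow> unit_scale p \<sigma>"
  unfolding unit_scale_def
  by (auto intro!: divide_left_mono elim!: modular_le_mono)

lemma unit_scale_0: "\<rho> > 0 \<Longrightarrow> unit_scale 0 \<rho>"
  by (simp add: unit_scale_def modular_le_def \<Phi>_0)

lemma unit_scale_scale:
  "unit_scale p \<rho> \<Longrightarrow> c \<noteq> 0 \<Longrightarrow> unit_scale (cseq_scale c p) (cmod c * \<rho>)"
  by (simp add: unit_scale_def cseq_scale_def norm_mult)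

text \<open>The modulus of \<open>p + q\<close> over \<open>\<rho> + \<sigma>\<close> is dominated
  by a convex combination of the moduli of \<open>p\<close> over \<open>\<rho>\<close> and
  \<open>q\<close> over \<open>\<sigma>\<close>, with coefficients proportional to the scales. This
  is the source of the triangle inequality.\<close>

lemma unit_scale_add:
  assumes "unit_scale p \<rho>" "unit_scale q \<sigma>"
  shows "unit_scale (p + q) (\<rho> + \<sigma>)"
proof -
  have pos: "\<rho> > 0" "\<sigma> > 0" using assms by (auto simp: unit_scale_def)
  let ?s = "\<rho> / (\<rho> + \<sigma>)" and ?t = "\<sigma> / (\<rho> + \<sigma>)"
  have st: "?s + ?t = 1" using pos by (simp add: add_divide_distrib[symmetric])
  have "modular_le (?s * 1 + ?t * 1) (\<lambda>m. ?s * (cmod (p m) / \<rho>) + ?t * (cmod (q m) / \<sigma>))"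
    using assms pos st by (intro modular_le_convex) (auto simp: unit_scale_def)
  moreover have "cmod ((p + q) m) / (\<rho> + \<sigma>) \<le> ?s * (cmod (p m) / \<rho>) + ?t * (cmod (q m) / \<sigma>)" for m
    using pos norm_triangle_ineq[of "p m" "q m"]
    by (simp add: add_divide_distrib[symmetric] divide_right_mono)
  ultimately show ?thesis
    using pos st by (auto simp: unit_scale_def elim!: modular_le_mono)
qed

section \<open>The norm as an infimum of scales\<close>

lemma luxemburg_norm_eq: "luxemburg_norm k \<Phi> w p = Inf (ennreal ` {\<rho>. unit_scale p \<rho>})"
proof -
  have "orlicz_modular k \<Phi> w (\<lambda>m. cmod (p m) / \<rho>) \<le> 1 \<longleftrightarrow>
      modular_le 1 (\<lambda>m. cmod (p m) / \<rho>)" if "\<rho> > 0" for \<rho>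
    using orlicz_modular_le_iff[of 1 "\<lambda>m. cmod (p m) / \<rho>"] that by simp
  then have "{ennreal \<rho> | \<rho>. \<rho> > 0 \<and> orlicz_modular k \<Phi> w (\<lambda>m. cmod (p m) / \<rho>) \<le> 1}
      = ennreal ` {\<rho>. unit_scale p \<rho>}"
    by (auto simp: unit_scale_def)
  then show ?thesis by (simp add: luxemburg_norm_def)
qed

lemma mem_L_iff: "p \<in> L \<longleftrightarrow> (\<exists>\<rho>. unit_scale p \<rho>)"
  by (auto simp: orlicz_space_def luxemburg_norm_eq Inf_less_iff)

lemma N_le:
  assumes "unit_scale p \<rho>"
  shows "N p \<le> \<rho>"
proof -
  have "luxemburg_norm k \<Phi> w p \<le> ennreal \<rho>"
    using assms unfolding luxemburg_norm_eq by (intro Inf_lower) auto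
  then show ?thesis
    using assms by (intro enn2real_leI) (auto simp: unit_scale_def)
qed

text \<open>Some admissible scale lies below \<open>\<rho>\<close>, and admissibility passes to
  larger scales; the strict inequality avoids asking whether the infimum is attained. Membership in
  \<open>L\<close> excludes the norm \<open>\<infinity>\<close>, which \<open>enn2real\<close> would
  send to 0.\<close>

lemma unit_scale_if_N_less:
  assumes "p \<in> L" "N p < \<rho>"
  shows "unit_scale p \<rho>"
proof -
  have "luxemburg_norm k \<Phi> w p < ennreal \<rho>"
    using assms unfolding orlicz_space_def
    by (metis enn2real_nonneg ennreal_enn2real ennreal_lessI infinity_ennreal_def le_less_trans
        mem_Collect_eq)
  then obtain \<sigma> where "unit_scale p \<sigma>" "ennreal \<sigma> < ennreal \<rho>"
    by (auto simp: luxemburg_norm_eq Inf_less_iff)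
  then show ?thesis
    using unit_scale_mono[of p \<sigma> \<rho>] by (auto simp: unit_scale_def ennreal_less_iff)
qed

text \<open>The partial sum over \<open>{m}\<close> bounds \<open>\<Phi>\<close> at the scaled
  coordinate, and \<open>\<Phi>\<close> tends to infinity. The constant depends on \<open>m\<close>
  but not on \<open>p\<close> or \<open>\<rho>\<close>, so each coordinate is a bounded
  functional.\<close>

lemma coordinate_bound:
  obtains T where "T > 0" "\<And>p \<rho>. unit_scale p \<rho> \<Longrightarrow> cmod (p m) \<le> T * \<rho>"
proof -
  have "eventually (\<lambda>t. \<Phi> t > 1 / weight m) at_top"
    using \<Phi>_at_top by (auto simp: filterlim_at_top_dense)
  then obtain T0 where T0: "\<And>t. t \<ge> T0 \<Longrightarrow> \<Phi> t > 1 / weight m"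
    by (auto simp: eventually_at_top_linorder)
  \<comment> \<open>The maximum with 1 gives the required positive constant.\<close>
  have "cmod (p m) \<le> max 1 T0 * \<rho>" if "unit_scale p \<rho>" for p \<rho>
  proof -
    have \<rho>: "\<rho> > 0" "modular_le 1 (\<lambda>m. cmod (p m) / \<rho>)"
      using that by (auto simp: unit_scale_def)
    then have "(\<Sum>i\<in>{m}. weight i * \<Phi> (cmod (p i) / \<rho>)) \<le> 1"
      unfolding modular_le_def by blast
    then have "\<Phi> (cmod (p m) / \<rho>) \<le> 1 / weight m"
      using weight_pos[of m] by (simp add: field_simps)
    then have "cmod (p m) / \<rho> < T0" using T0 by (meson not_le)
    then have "cmod (p m) / \<rho> \<le> max 1 T0" by simp
    then show ?thesis using \<rho>(1) by (simp add: pos_divide_le_eq)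
  qed
  then show ?thesis by (intro that[of "max 1 T0"]) auto
qed

section \<open>Vector space structure and norm axioms\<close>

lemma subspace_L: "cseq.subspace L"
  unfolding cseq.subspace_def
proof (intro conjI ballI allI)
  show "0 \<in> L" using unit_scale_0[of 1] by (auto simp: mem_L_iff)
  show "p + q \<in> L" if "p \<in> L" "q \<in> L" for p q
    using that unit_scale_add unfolding mem_L_iff by blast
  show "cseq_scale c p \<in> L" if "p \<in> L" for c p
  proof (cases "c = 0")
    case True
    then show ?thesis using \<open>0 \<in> L\<close> by simp
  next
    case False
    then show ?thesis using that unit_scale_scale by (auto simp: mem_L_iff)
  qed
qed

lemma N_0: "N 0 = 0"
proof -
  have "N 0 \<le> 0"
    by (rule field_le_epsilon) (use N_le[OF unit_scale_0] in auto)
  then show ?thesis using enn2real_nonneg[of "luxemburg_norm k \<Phi> w 0"] by linarith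
qed

lemma N_eq_0_iff:
  assumes "p \<in> L"
  shows "N p = 0 \<longleftrightarrow> p = 0"
proof
  assume "N p = 0"
  show "p = 0"
  proof
    fix m
    obtain T where T: "T > 0" "\<And>p \<rho>. unit_scale p \<rho> \<Longrightarrow> cmod (p m) \<le> T * \<rho>"
      using coordinate_bound by blast
    \<comment> \<open>Since the norm is 0, every positive scale is admissible; the scale
      \<open>e / T\<close> turns the coordinate bound into \<open>e\<close>.\<close>
    have "cmod (p m) \<le> 0 + e" if "e > 0" for e
      using T(2)[OF unit_scale_if_N_less[OF assms, of "e / T"]] T(1) that \<open>N p = 0\<close> by simp
    then have "cmod (p m) \<le> 0" by (rule field_le_epsilon)
    then show "p m = 0 m" by simp
  qed
qed (use N_0 in simp)

lemma N_scale_le: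
  assumes "p \<in> L" "c \<noteq> 0"
  shows "N (cseq_scale c p) \<le> cmod c * N p"
proof (rule field_le_epsilon)
  fix e :: real assume "e > 0"
  \<comment> \<open>The slack \<open>e / cmod c\<close> becomes exactly \<open>e\<close> after
    multiplication by \<open>cmod c\<close>.\<close>
  then have "unit_scale p (N p + e / cmod c)"
    using assms by (intro unit_scale_if_N_less) auto
  then have "N (cseq_scale c p) \<le> cmod c * (N p + e / cmod c)"
    using assms by (intro N_le unit_scale_scale)
  then show "N (cseq_scale c p) \<le> cmod c * N p + e"
    using assms by (simp add: distrib_left)
qed

lemma N_scale:
  assumes "p \<in> L"
  shows "N (cseq_scale c p) = cmod c * N p"
proof (cases "c = 0")
  case True
  then show ?thesis using N_0 by simp
next
  case False
  have "cseq_scale c p \<in> L" using subspace_L assms by (rule cseq.subspace_scale)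
  \<comment> \<open>The reverse inequality comes from scaling back by \<open>1 / c\<close>.\<close>
  then have "N (cseq_scale (1 / c) (cseq_scale c p)) \<le> cmod (1 / c) * N (cseq_scale c p)"
    using False by (intro N_scale_le) auto
  then have "cmod c * N p \<le> N (cseq_scale c p)"
    using False by (simp add: norm_divide field_simps)
  then show ?thesis using N_scale_le[OF assms False] by simp
qed

lemma N_add:
  assumes "p \<in> L" "q \<in> L"
  shows "N (p + q) \<le> N p + N q"
proof (rule field_le_epsilon)
  fix e :: real assume "e > 0"
  then have "unit_scale (p + q) ((N p + e / 2) + (N q + e / 2))"
    using assms by (intro unit_scale_add unit_scale_if_N_less) auto
  from N_le[OF this] show "N (p + q) \<le> N p + N q + e" by simp
qed

lemma normed_space: "complex_normed_space_on L N"
  unfolding complex_normed_space_on_def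
  using subspace_L N_eq_0_iff N_scale N_add by auto

section \<open>The induced metric and completeness\<close>

lemma metric_space: "Metric_space L (\<lambda>p q. N (p - q))"
proof
  \<comment> \<open>\<open>Metric_space\<close> demands symmetry for all sequences, also outside
    \<open>L\<close>, so it is read off the moduli in the definition of the norm.\<close>
  show "N (p - q) = N (q - p)" for p q
    by (simp add: luxemburg_norm_def norm_minus_commute)
  show "N (p - q) = 0 \<longleftrightarrow> p = q" if "p \<in> L" "q \<in> L" for p q
    using N_eq_0_iff[OF cseq.subspace_diff[OF subspace_L that]] by simp
  show "N (p - r) \<le> N (p - q) + N (q - r)" if "p \<in> L" "q \<in> L" "r \<in> L" for p q r
    using N_add[of "p - q" "q - r"] cseq.subspace_diff[OF subspace_L] that by simp
qed simp

lemma mcomplete: "Metric_space.mcomplete L (\<lambda>p q. N (p - q))"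
proof -
  interpret Metric_space L "\<lambda>p q. N (p - q)" by (rule metric_space)
  show ?thesis
    unfolding mcomplete_def
  proof (intro allI impI)
    fix P :: "nat \<Rightarrow> int \<Rightarrow> complex"
    assume "MCauchy P"
    then have PL: "P i \<in> L" for i
      by (auto simp: MCauchy_def)
    have cau: "\<exists>n0. \<forall>i\<ge>n0. \<forall>j\<ge>n0. unit_scale (P i - P j) e" if "e > 0" for e
      using \<open>MCauchy P\<close> that
        unit_scale_if_N_less[OF cseq.subspace_diff[OF subspace_L PL PL]]
      unfolding MCauchy_def by meson
    have "Cauchy (\<lambda>i. P i m)" for m
    proof (rule CauchyI)
      fix e :: real assume "e > 0"
      obtain T where T: "T > 0" "\<And>p \<rho>. unit_scale p \<rho> \<Longrightarrow> cmod (p m) \<le> T * \<rho>"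
        using coordinate_bound by blast
      \<comment> \<open>The scale \<open>e / (2 * T)\<close> bounds the coordinate difference by
        \<open>e / 2\<close>, which is strictly below \<open>e\<close>.\<close>
      obtain n0 where n0: "\<And>i j. i \<ge> n0 \<Longrightarrow> j \<ge> n0 \<Longrightarrow> unit_scale (P i - P j) (e / (2 * T))"
        using cau[of "e / (2 * T)"] \<open>e > 0\<close> T(1) by auto
      have "cmod (P i m - P j m) < e" if "i \<ge> n0" "j \<ge> n0" for i j
        using T(2)[OF n0[OF that]] T(1) \<open>e > 0\<close> by simp
      then show "\<exists>M. \<forall>i\<ge>M. \<forall>j\<ge>M. cmod (P i m - P j m) < e" by blast
    qed
    then have "\<exists>l. (\<lambda>i. P i m) \<longlonglongrightarrow> l" for m
      by (simp add: Cauchy_convergent_iff convergent_def)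
    then obtain q where q: "\<And>m. (\<lambda>i. P i m) \<longlonglongrightarrow> q m" by metis
    have close: "\<exists>n0. \<forall>i\<ge>n0. unit_scale (P i - q) e" if "e > 0" for e
    proof -
      obtain n0 where n0: "\<And>i j. i \<ge> n0 \<Longrightarrow> j \<ge> n0 \<Longrightarrow> unit_scale (P i - P j) e"
        using cau[OF \<open>e > 0\<close>] by auto
      \<comment> \<open>Fix \<open>i\<close> and let \<open>j\<close> tend to infinity: the bound on
        \<open>P i - P j\<close> at scale \<open>e\<close> passes to the coordinatewise
        limit.\<close>
      have "modular_le 1 (\<lambda>m. cmod ((P i - q) m) / e)" if "i \<ge> n0" for i
      proof (rule modular_le_LIMSEQ)
        show "(\<lambda>j. cmod ((P i - P j) m) / e) \<longlonglongrightarrow> cmod ((P i - q) m) / e" for m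
          using \<open>e > 0\<close> by (auto intro!: tendsto_intros q)
        show "\<forall>\<^sub>F j in sequentially. modular_le 1 (\<lambda>m. cmod ((P i - P j) m) / e)"
          using n0[OF that] by (auto simp: unit_scale_def eventually_sequentially)
      qed (use \<open>e > 0\<close> in auto)
      then show ?thesis using \<open>e > 0\<close> by (auto simp: unit_scale_def)
    qed
    \<comment> \<open>The limit is in \<open>L\<close> as the difference of \<open>P n\<close> and
      \<open>P n - q\<close>.\<close>
    from close[of 1] obtain n where "P n - q \<in> L" by (auto simp: mem_L_iff)
    then have "q \<in> L"
      using cseq.subspace_diff[OF subspace_L PL[of n], of "P n - q"] by simp
    \<comment> \<open>\<open>N_le\<close> is not strict; halving \<open>e\<close> gives the strict
      inequality.\<close>
    moreover have "\<exists>n0. \<forall>i\<ge>n0. P i \<in> L \<and> N (P i - q) < e" if "e > 0" for e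
      using close[of "e / 2"] that PL N_le by fastforce
    ultimately show "\<exists>x. limitin mtopology P x sequentially"
      unfolding limit_metric_sequentially by blast
  qed
qed

section \<open>The span of the Orlicz class\<close>

lemma class_subset_L: "orlicz_class k \<Phi> w \<subseteq> L"
proof
  fix p assume "p \<in> orlicz_class k \<Phi> w"
  then obtain C where C: "C \<ge> 0" "orlicz_modular k \<Phi> w (\<lambda>m. cmod (p m)) = ennreal C"
    unfolding orlicz_class_def
    by (cases "orlicz_modular k \<Phi> w (\<lambda>m. cmod (p m))") auto
  \<comment> \<open>Division by \<open>\<rho> \<ge> 1\<close> is a convex combination with the zero
    sequence, whose modular is 0, so it lowers the bound \<open>C\<close> to
    \<open>C / \<rho>\<close>, which is at most 1.\<close>
  define \<rho> where "\<rho> = max 1 C"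
  have \<rho>: "\<rho> \<ge> 1" "\<rho> \<ge> C" by (auto simp: \<rho>_def)
  have "modular_le C (\<lambda>m. cmod (p m))"
    using orlicz_modular_le_iff[of C "\<lambda>m. cmod (p m)"] C by simp
  moreover have "modular_le 0 (\<lambda>m. 0)"
    by (simp add: modular_le_def \<Phi>_0)
  ultimately have *: "modular_le (1 / \<rho> * C + (1 - 1 / \<rho>) * 0) (\<lambda>m. 1 / \<rho> * cmod (p m) + (1 - 1 / \<rho>) * 0)"
    using \<rho> by (intro modular_le_convex) auto
  have "1 / \<rho> * C \<le> 1" using \<rho> by simp
  with * have "modular_le 1 (\<lambda>m. cmod (p m) / \<rho>)"
    by (force simp: modular_le_def)
  then show "p \<in> L" using \<rho> by (auto simp: mem_L_iff unit_scale_def intro!: exI[of _ \<rho>])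
qed

text \<open>The class need not be closed under scaling, but each \<open>p\<close> in
  \<open>L\<close> is a multiple of an element of it: at an admissible scale \<open>\<rho>\<close>,
  the sequence \<open>p\<close> divided by \<open>\<rho>\<close> has modular at most 1.\<close>

lemma span_class: "cseq.span (orlicz_class k \<Phi> w) = L"
proof
  show "cseq.span (orlicz_class k \<Phi> w) \<subseteq> L"
    by (rule cseq.span_minimal[OF class_subset_L subspace_L])
  show "L \<subseteq> cseq.span (orlicz_class k \<Phi> w)"
  proof
    fix p assume "p \<in> L"
    then obtain \<rho> where \<rho>: "\<rho> > 0" "modular_le 1 (\<lambda>m. cmod (p m) / \<rho>)"
      by (auto simp: mem_L_iff unit_scale_def)
    define q where "q = cseq_scale (1 / of_real \<rho>) p"
    have "orlicz_modular k \<Phi> w (\<lambda>m. cmod (q m)) \<le> ennreal 1"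
      using \<rho> by (subst orlicz_modular_le_iff) (auto simp: q_def cseq_scale_def norm_divide)
    then have "q \<in> orlicz_class k \<Phi> w"
      by (auto simp: orlicz_class_def intro: le_less_trans)
    then have "cseq_scale (of_real \<rho>) q \<in> cseq.span (orlicz_class k \<Phi> w)"
      by (intro cseq.span_scale cseq.span_base)
    then show "p \<in> cseq.span (orlicz_class k \<Phi> w)"
      using \<rho>(1) by (simp add: q_def)
  qed
qed

end

theorem theorem1:
  fixes \<Phi> :: "real \<Rightarrow> real" and w :: "int \<Rightarrow> real" and k :: real
  assumes "orlicz_function \<Phi>"
    and "\<And>m. w m > 0"
  shows "cseq.span (orlicz_class k \<Phi> w) = orlicz_space k \<Phi> w \<and>
         complex_banach_space_on (orlicz_space k \<Phi> w)
           (\<lambda>p. enn2real (luxemburg_norm k \<Phi> w p))"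
proof -
  interpret weighted_orlicz \<Phi> w k by unfold_locales (use assms in auto)
  show ?thesis
    unfolding complex_banach_space_on_def
    using span_class normed_space mcomplete by blast
qed

end
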